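(* Let $\boldsymbol{H}\in\mathbb{R}^{d\times d}$ be a random symmetric positive-definite matrix, let $\boldsymbol{x}_0,\boldsymbol{x}^\star\in\mathbb{R}^d$ be random vectors such that $\boldsymbol{x}_0-\boldsymbol{x}^\star$ is independent of $\boldsymbol{H}$ and $\mathbb{E}\,(\boldsymbol{x}_0-\boldsymbol{x}^\star)(\boldsymbol{x}_0-\boldsymbol{x}^\star)^\top=\frac{R^2}{d}\boldsymbol{I}$, and let $f(\boldsymbol{x})=\frac12(\boldsymbol{x}-\boldsymbol{x}^\star)^\top\boldsymbol{H}(\boldsymbol{x}-\boldsymbol{x}^\star)$. Let $\mu$ be the expected spectral distribution of $\boldsymbol{H}$. Let $\boldsymbol{x}_t$ be the $t$-th iterate generated from $\boldsymbol{x}_0$ by an oblivious first-order method applied to $f$, and let $P_t$ be its residual polynomial. Then $$\mathbb{E}\|\boldsymbol{x}_t-\boldsymbol{x}^\star\|^2=R^2\int P_t^2\,\mathrm{d}\mu .$$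
   Context: $\|\cdot\|$ is the Euclidean norm; $\mathbb{E}$ is the expectation over the random $\boldsymbol{H},\boldsymbol{x}_0,\boldsymbol{x}^\star$. The method itself is deterministic. First-order method: the iterates satisfy $\boldsymbol{x}_{t+1}\in\boldsymbol{x}_0+\mathrm{span}\{\nabla f(\boldsymbol{x}_0),\dots,\nabla f(\boldsymbol{x}_t)\}$ for all $t\ge 0$. Oblivious: the coefficients of these linear combinations are real numbers fixed in advance (they do not depend on $\boldsymbol{H},\boldsymbol{x}_0,\boldsymbol{x}^\star$ or on the iterates). Residual polynomial: for such a method there is, for each $t$, a (deterministic) real polynomial $P_t$ of degree at most $t$ with $P_t(0)=1$, determined by the coefficients of the method, such that $\boldsymbol{x}_t-\boldsymbol{x}^\star=P_t(\boldsymbol{H})(\boldsymbol{x}_0-\boldsymbol{x}^\star)$. It is called the residual polynomial of the method at iteration $t$. Spectral distributions: if $\boldsymbol{H}$ has eigenvalues $\lambda_1,\dots,\lambda_d$, its empirical spectral distribution is the (random) probability measure $\mu_{\boldsymbol{H}}=\frac1d\sum_{i=1}^d\delta_{\lambda_i}$. The expected spectral distribution is $\mu=\mathbb{E}_{\boldsymbol{H}}[\mu_{\boldsymbol{H}}]$, i.e. the measure with $\int\varphi\,\mathrm{d}\mu=\mathbb{E}\int\varphi\,\mathrm{d}\mu_{\boldsymbol{H}}$ for every continuous compactly supported $\varphi$ on $\mathbb{R}$. *)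

theory Defs
  imports
    "HOL-Probability.Probability"
    "HOL-Computational_Algebra.Computational_Algebra"
begin

subsection \<open>Matrices and their eigenvalues\<close>

definition spd_matrix :: "real^'n^'n \<Rightarrow> bool" where
  "spd_matrix A \<longleftrightarrow> transpose A = A \<and> (\<forall>v. v \<noteq> 0 \<longrightarrow> 0 < v \<bullet> (A *v v))"

text \<open>The class operations \<open>*\<close> and \<open>^\<close> on \<open>real^'n^'n\<close> are componentwise, hence a
  separate power for the matrix product.\<close>

primrec matrix_pow :: "real^'n^'n \<Rightarrow> nat \<Rightarrow> real^'n^'n" where
  "matrix_pow A 0 = mat 1"
| "matrix_pow A (Suc k) = A ** matrix_pow A k"

definition poly_matrix :: "real poly \<Rightarrow> real^'n^'n \<Rightarrow> real^'n^'n" where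
  "poly_matrix P A = (\<Sum>k\<le>degree P. coeff P k *\<^sub>R matrix_pow A k)"

definition charpoly :: "real^'n^'n \<Rightarrow> real poly" where
  "charpoly A = det (\<chi> i j. (if i = j then [:0, 1:] else 0) - [:A $ i $ j:])"

text \<open>Real eigenvalues, repeated according to algebraic multiplicity; for symmetric \<open>A\<close>
  this multiset has exactly \<open>CARD('n)\<close> elements.\<close>

definition eigenvalues :: "real^'n^'n \<Rightarrow> real multiset" where
  "eigenvalues A = proots (charpoly A)"


subsection \<open>Independence\<close>

text \<open>The library's \<open>indep_var\<close> needs both random variables to have the same type; this is
  its content for two different types.\<close>

definition independent_rvs ::
    "'a measure \<Rightarrow> ('a \<Rightarrow> 'b::topological_space) \<Rightarrow> ('a \<Rightarrow> 'c::topological_space) \<Rightarrow> bool" where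
  "independent_rvs M X Y \<longleftrightarrow>
     X \<in> borel_measurable M \<and> Y \<in> borel_measurable M \<and>
     prob_space.indep_set M {X -` A \<inter> space M | A. A \<in> sets borel}
                            {Y -` B \<inter> space M | B. B \<in> sets borel}"


subsection \<open>Spectral distributions\<close>

definition empirical_spectral_distribution :: "real^'n^'n \<Rightarrow> real measure" where
  "empirical_spectral_distribution A =
     measure_of UNIV (sets borel)
       (\<lambda>S. (\<Sum>l\<in>#eigenvalues A. emeasure (return borel l) S) / of_nat CARD('n))"

text \<open>That \<open>\<mu>\<close> is the expected spectral distribution of the random matrix \<open>H\<close>, i.e. the
  mean of the empirical ones, by testing against continuous compactly supported functions.
  The integrability conjunct only excludes measures for which the left-hand integral does not
  exist (the Bochner integral would then be \<open>0\<close> by convention).\<close>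

definition expected_spectral_distribution ::
    "'a measure \<Rightarrow> ('a \<Rightarrow> real^'n^'n) \<Rightarrow> real measure \<Rightarrow> bool" where
  "expected_spectral_distribution M H \<mu> \<longleftrightarrow>
     sets \<mu> = sets borel \<and>
     (\<forall>\<phi> :: real \<Rightarrow> real. continuous_on UNIV \<phi> \<longrightarrow> compact (closure {l. \<phi> l \<noteq> 0}) \<longrightarrow>
        integrable \<mu> \<phi> \<and>
        (LINT l|\<mu>. \<phi> l) =
          (LINT \<omega>|M. (LINT l|empirical_spectral_distribution (H \<omega>). \<phi> l)))"


subsection \<open>Quadratic objectives and oblivious first-order methods\<close>

definition quadratic :: "real^'n^'n \<Rightarrow> real^'n \<Rightarrow> real^'n \<Rightarrow> real" where
  "quadratic H z x = 1 / 2 * ((x - z) \<bullet> (H *v (x - z)))"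

definition gradient :: "('v::real_inner \<Rightarrow> real) \<Rightarrow> 'v \<Rightarrow> 'v" where
  "gradient f x = (THE g. GDERIV f x :> g)"

text \<open>An oblivious first-order method is given by its coefficients: \<open>c t s\<close> is the weight of the
  \<open>s\<close>-th gradient in the iterate \<open>t + 1\<close>. The starting point is \<open>x 0\<close>.\<close>

definition oblivious_iterates ::
    "(nat \<Rightarrow> nat \<Rightarrow> real) \<Rightarrow> ('v::real_inner \<Rightarrow> real) \<Rightarrow> (nat \<Rightarrow> 'v) \<Rightarrow> bool" where
  "oblivious_iterates c f x \<longleftrightarrow>
     (\<forall>t. x (Suc t) = x 0 + (\<Sum>s\<le>t. c t s *\<^sub>R gradient f (x s)))"

definition is_residual_polynomial ::
    "'n::finite itself \<Rightarrow> (nat \<Rightarrow> nat \<Rightarrow> real) \<Rightarrow> nat \<Rightarrow> real poly \<Rightarrow> bool" where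
  "is_residual_polynomial TYPE('n) c t P \<longleftrightarrow>
     degree P \<le> t \<and> poly P 0 = 1 \<and>
     (\<forall>(H :: real^'n^'n) z x. spd_matrix H \<longrightarrow> oblivious_iterates c (quadratic H z) x \<longrightarrow>
        x t - z = poly_matrix P H *v (x 0 - z))"

text \<open>The description is proper: the coefficients yield such a polynomial by the recursion
  \<open>P\<^sub>0 = 1\<close>, \<open>P\<^sub>t\<^sub>+\<^sub>1 = 1 + X * (\<Sum>s\<le>t. c t s * P\<^sub>s)\<close>, and taking \<open>H\<close> to be the positive multiples
  of the identity shows that it is unique.\<close>

definition residual_polynomial ::
    "'n::finite itself \<Rightarrow> (nat \<Rightarrow> nat \<Rightarrow> real) \<Rightarrow> nat \<Rightarrow> real poly" where
  "residual_polynomial n c t = (THE P. is_residual_polynomial n c t P)"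

end

theory Submission
  imports Defs
begin

text \<open>
  Put \<open>u = x\<^sub>0 - x\<^sup>\<star>\<close>. Since \<open>x\<^sub>t - x\<^sup>\<star> = P\<^sub>t(H) u\<close> and \<open>u\<close> is independent of \<open>H\<close>, Tonelli's theorem
  allows integrating over \<open>u\<close> first with \<open>H\<close> frozen, which by isotropy gives
  \<open>R\<^sup>2 / d\<close> times the trace of \<open>P\<^sub>t(H)\<^sup>2\<close>. By the spectral theorem this trace is the sum of \<open>P\<^sub>t\<^sup>2\<close> over the eigenvalues of \<open>H\<close>, that is,
  \<open>d\<close> times the integral of \<open>P\<^sub>t\<^sup>2\<close> against the empirical spectral distribution.
\<close>

subsection \<open>Polynomials of matrices\<close>

lemma matrix_add_rdistrib_real: "((A :: real^'n^'n) + B) ** C = A ** C + B ** C"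
  by (simp add: matrix_matrix_mult_def vec_eq_iff sum.distrib algebra_simps)

text \<open>Padding with zero coefficients up to any common bound lets polynomials of different
  degrees be handled over one index range.\<close>

lemma poly_matrix_eq_sum:
  assumes "degree P \<le> N"
  shows "poly_matrix P A = (\<Sum>k\<le>N. coeff P k *\<^sub>R matrix_pow A k)"
  unfolding poly_matrix_def
  by (rule sum.mono_neutral_left) (use assms in \<open>auto simp: coeff_eq_0\<close>)

lemma poly_matrix_0 [simp]: "poly_matrix 0 A = 0"
  by (simp add: poly_matrix_def)

lemma poly_matrix_add: "poly_matrix (P + Q) A = poly_matrix P A + poly_matrix Q A"
proof -
  define N where "N = max (degree P) (degree Q)"
  have "degree P \<le> N" "degree Q \<le> N" "degree (P + Q) \<le> N"
    by (auto simp: N_def degree_add_le)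
  then show ?thesis
    by (simp add: poly_matrix_eq_sum[of _ N] scaleR_add_left sum.distrib)
qed

lemma poly_matrix_smult: "poly_matrix (smult a P) A = a *\<^sub>R poly_matrix P A"
  by (simp add: poly_matrix_eq_sum[of _ "degree P"] degree_smult_le scaleR_sum_right)

lemma poly_matrix_sum:
  "finite S \<Longrightarrow> poly_matrix (\<Sum>s\<in>S. P s) A = (\<Sum>s\<in>S. poly_matrix (P s) A)"
  by (induction S rule: finite_induct) (auto simp: poly_matrix_add)

lemma matrix_mult_sum_right:
  fixes A :: "real^'n^'n"
  shows "A ** (\<Sum>s\<in>S. B s) = (\<Sum>s\<in>S. A ** B s)"
  by (induction S rule: infinite_finite_induct) (simp_all add: matrix_add_ldistrib)

lemma matrix_mult_scaleR_right:
  fixes A :: "real^'n^'n"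
  shows "A ** (a *\<^sub>R B) = a *\<^sub>R (A ** B)"
  by (simp add: matrix_matrix_mult_def vec_eq_iff sum_distrib_left algebra_simps)

text \<open>Horner's scheme for a matrix argument; it opens \<open>poly_matrix\<close> to induction
  on the polynomial.\<close>

lemma poly_matrix_pCons: "poly_matrix (pCons a P) A = a *\<^sub>R mat 1 + A ** poly_matrix P A"
proof -
  have "poly_matrix (pCons a P) A = (\<Sum>k\<le>Suc (degree P). coeff (pCons a P) k *\<^sub>R matrix_pow A k)"
    by (rule poly_matrix_eq_sum) (simp add: degree_pCons_le)
  also have "\<dots> = a *\<^sub>R mat 1 + (\<Sum>k\<le>degree P. coeff P k *\<^sub>R (A ** matrix_pow A k))"
    by (subst sum.atMost_Suc_shift) simp
  finally show ?thesis
    by (simp add: poly_matrix_def matrix_mult_sum_right matrix_mult_scaleR_right)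
qed

subsection \<open>The spectral theorem\<close>

lemma symmetric_matrix_inner:
  fixes A :: "real^'n^'n"
  assumes "transpose A = A"
  shows "(A *v v) \<bullet> w = v \<bullet> (A *v w)"
  by (metis assms dot_lmul_matrix vector_transpose_matrix)

text \<open>A maximiser of the quadratic form on the unit sphere of \<open>S\<close> is an
  eigenvector, with the maximum as eigenvalue. Invariance keeps the residual
  \<open>A *v v - m *\<^sub>R v\<close> in \<open>S\<close>, where it can serve as a direction of
  variation.\<close>

lemma symmetric_invariant_subspace_eigenvector:
  fixes A :: "real^'n^'n"
  assumes sym: "transpose A = A" and S: "subspace S" "S \<noteq> {0}"
    and inv: "\<And>v. v \<in> S \<Longrightarrow> A *v v \<in> S"
  obtains v m where "v \<in> S" "norm v = 1" "A *v v = m *\<^sub>R v"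
proof -
  have sym': "(A *v v) \<bullet> w = v \<bullet> (A *v w)" for v w
    by (rule symmetric_matrix_inner[OF sym])
  have "compact (S \<inter> sphere 0 1)"
    by (simp add: closed_Int_compact closed_subspace S)
  moreover obtain u where u: "u \<in> S" "u \<noteq> 0"
    using S subspace_0 by blast
  then have "u /\<^sub>R norm u \<in> S \<inter> sphere 0 1"
    using S by (simp add: subspace_scale)
  then have "S \<inter> sphere 0 1 \<noteq> {}" by blast
  moreover have "continuous_on (S \<inter> sphere 0 1) (\<lambda>v. v \<bullet> (A *v v))"
    by (intro continuous_intros linear_continuous_on) simp
  ultimately obtain v where "v \<in> S \<inter> sphere 0 1"
    and "\<forall>w \<in> S \<inter> sphere 0 1. w \<bullet> (A *v w) \<le> v \<bullet> (A *v v)"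
    using continuous_attains_sup[of "S \<inter> sphere 0 1" "\<lambda>v. v \<bullet> (A *v v)"] by blast
  then have v: "v \<in> S" "norm v = 1"
    and max: "\<And>w. w \<in> S \<Longrightarrow> norm w = 1 \<Longrightarrow> w \<bullet> (A *v w) \<le> v \<bullet> (A *v v)"
    by auto
  define m where "m = v \<bullet> (A *v v)"
  \<comment> \<open>Both sides scale quadratically, so the bound passes from unit vectors to all of
    \<open>S\<close>.\<close>
  have le: "w \<bullet> (A *v w) \<le> m * (w \<bullet> w)" if "w \<in> S" for w
  proof (cases "w = 0")
    case False
    have "(w /\<^sub>R norm w) \<bullet> (A *v (w /\<^sub>R norm w)) \<le> m"
      unfolding m_def using that False S by (intro max) (auto simp: subspace_scale)
    then have "(w \<bullet> (A *v w)) / (norm w)\<^sup>2 \<le> m"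
      by (simp add: matrix_vector_mult_scaleR power2_eq_square field_simps)
    then show ?thesis
      using False by (simp add: field_simps dot_square_norm)
  qed auto
  define w where "w = A *v v - m *\<^sub>R v"
  have wS: "w \<in> S"
    unfolding w_def using S v inv by (intro subspace_diff subspace_scale) auto
  have vv: "v \<bullet> v = 1"
    using v by (simp add: dot_square_norm)
  have wv: "w \<bullet> v = 0"
    by (simp add: w_def inner_diff_left vv m_def inner_commute[of "A *v v"])
  \<comment> \<open>The cross terms of the form at \<open>v + t *\<^sub>R w\<close> turn out to be
    \<open>w \<bullet> w\<close>, so first-order optimality of \<open>v\<close> will force
    \<open>w = 0\<close>.\<close>
  have wAv: "w \<bullet> (A *v v) = w \<bullet> w"
    using wv by (simp add: w_def inner_diff_right)
  have vAw: "v \<bullet> (A *v w) = w \<bullet> w"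
    using wAv sym'[of v w] by (simp add: inner_commute)
  \<comment> \<open>Moving from the maximiser \<open>v\<close> in the direction of its residual \<open>w\<close> cannot pay off to first order.\<close>
  have bound: "2 * (w \<bullet> w) \<le> t * (m * (w \<bullet> w) - w \<bullet> (A *v w))" if "t > 0" for t
  proof -
    have "(v + t *\<^sub>R w) \<bullet> (A *v (v + t *\<^sub>R w)) \<le> m * ((v + t *\<^sub>R w) \<bullet> (v + t *\<^sub>R w))"
      using S v wS by (intro le subspace_add subspace_scale) auto
    then have "m + 2 * t * (w \<bullet> w) + t * (t * (w \<bullet> (A *v w))) \<le> m + t * (t * (m * (w \<bullet> w)))"
      using vv wv wAv vAw
      by (simp add: matrix_vector_right_distrib matrix_vector_mult_scaleR inner_add_left
          inner_add_right inner_commute[of v w] m_def[symmetric] algebra_simps)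
    then have "t * (2 * (w \<bullet> w)) \<le> t * (t * (m * (w \<bullet> w) - w \<bullet> (A *v w)))"
      by (simp add: algebra_simps)
    with that show ?thesis
      by (simp only: mult_le_cancel_left_pos)
  qed
  have "w \<bullet> w \<le> 0"
  proof (rule field_le_epsilon)
    fix e :: real assume e: "e > 0"
    \<comment> \<open>With \<open>t = e / C\<close> in \<open>bound\<close> the step length shrinks
      with \<open>e\<close>; the \<open>+ 1\<close> keeps \<open>C\<close> positive when the
      coefficient is 0.\<close>
    define C where "C = \<bar>m * (w \<bullet> w) - w \<bullet> (A *v w)\<bar> + 1"
    have C: "C > 0" "m * (w \<bullet> w) - w \<bullet> (A *v w) \<le> C" by (auto simp: C_def)
    have "2 * (w \<bullet> w) \<le> (e / C) * (m * (w \<bullet> w) - w \<bullet> (A *v w))"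
      using e C by (intro bound) auto
    also have "\<dots> \<le> (e / C) * C"
      using e C by (intro mult_left_mono) auto
    finally show "w \<bullet> w \<le> 0 + e"
      using C e by (smt (verit) inner_ge_zero nonzero_eq_divide_eq)
  qed
  then have "w = 0"
    using inner_ge_zero[of w] inner_eq_zero_iff[of w] by linarith
  then have "A *v v = m *\<^sub>R v"
    by (simp add: w_def)
  with v that show ?thesis by blast
qed

text \<open>An orthonormal set of eigenvectors of largest size must span: by symmetry its orthogonal
  complement is invariant, and a nonzero complement would supply one more eigenvector.\<close>

lemma symmetric_orthonormal_eigenbasis:
  fixes A :: "real^'n^'n"
  assumes sym: "transpose A = A"
  obtains f :: "'n \<Rightarrow> real^'n" and d :: "'n \<Rightarrow> real"
  where "\<And>i j. f i \<bullet> f j = (if i = j then 1 else 0)" "\<And>i. A *v f i = d i *\<^sub>R f i"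
proof -
  have sym': "(A *v v) \<bullet> w = v \<bullet> (A *v w)" for v w
    by (rule symmetric_matrix_inner[OF sym])
  define ok where "ok B \<longleftrightarrow> pairwise orthogonal B \<and> (\<forall>v\<in>B. norm v = 1 \<and> (\<exists>m. A *v v = m *\<^sub>R v))"
    for B :: "(real^'n) set"
  have ok_indep: "independent B" if "ok B" for B
    using that by (intro pairwise_orthogonal_independent) (auto simp: ok_def)
  then have ok_card: "finite B \<and> card B \<le> CARD('n)" if "ok B" for B
    using independent_bound[of B] that by simp
  have "ok {}" by (simp add: ok_def)
  \<comment> \<open>Orthogonal unit vectors are independent, so the dimension bounds the size of
    such sets and a largest one exists.\<close>
  then obtain B where B: "ok B" and max: "\<And>B'. ok B' \<Longrightarrow> card B' \<le> card B"
    using ex_has_greatest_nat[of ok "{}" card "Suc CARD('n)"] ok_card by (auto simp: less_Suc_eq_le)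
  define S where "S = {v. \<forall>b\<in>B. orthogonal b v}"
  have "subspace S"
    by (auto simp: S_def subspace_def orthogonal_def inner_add_right)
  have "S = {0}"
  proof (rule ccontr)
    assume "S \<noteq> {0}"
    moreover have "A *v v \<in> S" if "v \<in> S" for v
      unfolding S_def orthogonal_def
    proof safe
      fix b assume b: "b \<in> B"
      then obtain m where "A *v b = m *\<^sub>R b" using B by (auto simp: ok_def)
      then show "b \<bullet> (A *v v) = 0"
        using that b sym'[of b v] by (auto simp: S_def orthogonal_def)
    qed
    ultimately obtain v m where v: "v \<in> S" "norm v = 1" "A *v v = m *\<^sub>R v"
      using symmetric_invariant_subspace_eigenvector[OF sym \<open>subspace S\<close>] by metis
    have "ok (insert v B)"
      using B v by (auto simp: ok_def S_def pairwise_insert orthogonal_commute)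
    moreover have "v \<notin> B"
      using v by (auto simp: S_def orthogonal_def dot_square_norm)
    ultimately show False
      using max[of "insert v B"] ok_card[OF B] by simp
  qed
  have "span B = UNIV"
  proof (rule ccontr)
    assume "span B \<noteq> UNIV"
    then obtain a where "a \<noteq> 0" "\<forall>x\<in>span B. a \<bullet> x = 0"
      using span_not_UNIV_orthogonal by blast
    then have "a \<in> S" by (auto simp: S_def orthogonal_def inner_commute span_base)
    with \<open>S = {0}\<close> \<open>a \<noteq> 0\<close> show False by auto
  qed
  then have "card B = CARD('n)"
    using basis_card_eq_dim[of B UNIV] ok_indep[OF B] by (simp add: dim_UNIV)
  \<comment> \<open>Indexing the basis by \<open>'n\<close> itself makes the eigenvectors usable as
    columns of a square matrix.\<close>
  then obtain f :: "'n \<Rightarrow> real^'n" where f: "bij_betw f UNIV B"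
    using ok_card[OF B] by (metis finite finite_same_card_bij)
  then have fB: "f i \<in> B" for i
    by (auto simp: bij_betw_def)
  have "f i \<bullet> f j = (if i = j then 1 else 0)" for i j
  proof (cases "i = j")
    case False
    then have "f i \<noteq> f j"
      using f by (auto simp: bij_betw_def inj_def)
    with False show ?thesis
      using B fB[of i] fB[of j] by (auto simp: ok_def pairwise_def orthogonal_def)
  next
    case True
    with B fB[of i] show ?thesis by (simp add: ok_def dot_square_norm)
  qed
  moreover have "\<exists>m. A *v f i = m *\<^sub>R f i" for i
    using B fB[of i] by (simp add: ok_def)
  then obtain d where "A *v f i = d i *\<^sub>R f i" for i
    by metis
  ultimately show ?thesis by (rule that)
qed

section \<open>Orthogonal diagonalization\<close>

definition diag_matrix :: "('n \<Rightarrow> real) \<Rightarrow> real^'n^'n" where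
  "diag_matrix d = (\<chi> i j. if i = j then d i else 0)"

lemma diag_matrix_mult: "diag_matrix d ** diag_matrix e = diag_matrix (\<lambda>i. d i * e i)"
  by (simp add: diag_matrix_def matrix_matrix_mult_def vec_eq_iff if_distrib[of "\<lambda>x. x * _"] cong: if_cong)

lemma trace_diag_matrix: "trace (diag_matrix d) = (\<Sum>i\<in>UNIV. d i)"
  by (simp add: trace_def diag_matrix_def)

text \<open>The eigenvectors become the columns of \<open>U\<close>; read column by column, the
  eigenvalue equations say \<open>A ** U = U ** diag_matrix d\<close>.\<close>

theorem symmetric_matrix_diagonalization:
  fixes A :: "real^'n^'n"
  assumes "transpose A = A"
  obtains U d where "orthogonal_matrix U" "A = U ** diag_matrix d ** transpose U"
proof -
  obtain f :: "'n \<Rightarrow> real^'n" and d where f: "\<And>i j. f i \<bullet> f j = (if i = j then 1 else 0)"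
    and d: "\<And>i. A *v f i = d i *\<^sub>R f i"
    using symmetric_orthonormal_eigenbasis[OF assms] by blast
  define U :: "real^'n^'n" where "U = (\<chi> i j. f j $ i)"
  have "transpose U ** U = mat 1"
    using f by (simp add: U_def transpose_def matrix_matrix_mult_def mat_def vec_eq_iff inner_vec_def)
  then have U: "orthogonal_matrix U"
    by (simp add: orthogonal_matrix)
  have "(A ** U) $ i $ j = (U ** diag_matrix d) $ i $ j" for i j
  proof -
    have "(A ** U) $ i $ j = (A *v f j) $ i"
      by (simp add: U_def matrix_matrix_mult_def matrix_vector_mult_def)
    also have "\<dots> = (U ** diag_matrix d) $ i $ j"
      by (simp add: d U_def diag_matrix_def matrix_matrix_mult_def if_distrib[of "\<lambda>x. _ * x"] cong: if_cong)
    finally show ?thesis .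
  qed
  then have "A ** U = U ** diag_matrix d"
    by (simp add: vec_eq_iff)
  then have "A = U ** diag_matrix d ** transpose U"
    using U by (metis matrix_mul_assoc matrix_mul_rid orthogonal_matrix_def)
  with U that show ?thesis by blast
qed

section \<open>Calculus of matrices diagonalized by one orthogonal matrix\<close>

context
  fixes U :: "real^'n^'n"
  assumes U: "orthogonal_matrix U"
begin

lemma conjugate_diag_matrix_scaleR_mat_1: "U ** diag_matrix (\<lambda>_. a) ** transpose U = a *\<^sub>R mat 1"
proof -
  have "diag_matrix (\<lambda>_. a) = a *\<^sub>R (mat 1 :: real^'n^'n)"
    by (simp add: diag_matrix_def mat_def vec_eq_iff)
  then show ?thesis
    using U by (simp add: orthogonal_matrix_def matrix_mult_scaleR_right flip: scalar_matrix_assoc)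
qed

lemma conjugate_diag_matrix_mult:
  "(U ** diag_matrix a ** transpose U) ** (U ** diag_matrix b ** transpose U) =
     U ** diag_matrix (\<lambda>i. a i * b i) ** transpose U"
proof -
  have "(U ** diag_matrix a ** transpose U) ** (U ** diag_matrix b ** transpose U) =
      U ** diag_matrix a ** (transpose U ** U) ** diag_matrix b ** transpose U"
    by (simp only: matrix_mul_assoc)
  also have "\<dots> = U ** diag_matrix (\<lambda>i. a i * b i) ** transpose U"
    using U by (simp add: orthogonal_matrix_def diag_matrix_mult flip: matrix_mul_assoc)
  finally show ?thesis .
qed

lemma conjugate_diag_matrix_add:
  "U ** diag_matrix (\<lambda>i. a i + b i) ** transpose U =
     U ** diag_matrix a ** transpose U + U ** diag_matrix b ** transpose U"
proof -
  have "diag_matrix (\<lambda>i. a i + b i) = diag_matrix a + diag_matrix b"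
    by (simp add: diag_matrix_def vec_eq_iff)
  then show ?thesis
    by (simp add: matrix_add_ldistrib matrix_add_rdistrib_real)
qed

lemma trace_conjugate_diag_matrix: "trace (U ** diag_matrix a ** transpose U) = (\<Sum>i\<in>UNIV. a i)"
  using U by (metis matrix_mul_assoc matrix_mul_lid orthogonal_matrix_def trace_diag_matrix trace_mul_sym)

lemma transpose_conjugate_diag_matrix:
  "transpose (U ** diag_matrix a ** transpose U) = U ** diag_matrix a ** transpose U"
proof -
  have "transpose (diag_matrix a) = diag_matrix a"
    by (auto simp: transpose_def diag_matrix_def vec_eq_iff)
  then show ?thesis
    by (simp add: matrix_transpose_mul matrix_mul_assoc)
qed

text \<open>With \<open>U\<close> fixed, conjugated diagonal matrices add and multiply entrywise, so
  the Horner recursion for \<open>A\<close> is the one for each \<open>d i\<close>.\<close>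

lemma poly_matrix_conjugate:
  assumes A: "A = U ** diag_matrix d ** transpose U"
  shows "poly_matrix P A = U ** diag_matrix (\<lambda>i. poly P (d i)) ** transpose U"
proof (induction P)
  case 0
  then show ?case
    using conjugate_diag_matrix_scaleR_mat_1[of 0] by simp
next
  case (pCons a P)
  then show ?case
    by (simp add: poly_matrix_pCons conjugate_diag_matrix_add conjugate_diag_matrix_scaleR_mat_1
        A conjugate_diag_matrix_mult del: scaleR_left.add)
qed

text \<open>Evaluation at \<open>l\<close> passes through the permutation expansion of the
  determinant. This leaves a real matrix, for which the determinant is multiplicative and the
  factors \<open>U\<close> and \<open>transpose U\<close> cancel.\<close>

lemma poly_charpoly_conjugate:
  assumes A: "A = U ** diag_matrix d ** transpose U"
  shows "poly (charpoly A) l = (\<Prod>i\<in>UNIV. l - d i)"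
proof -
  have "poly (charpoly A) l = det (l *\<^sub>R mat 1 - A)"
    unfolding charpoly_def det_def
    by (simp add: poly_sum poly_prod mat_def if_distrib[of "\<lambda>p. poly p l"] if_distrib[of "\<lambda>x. l * x"]
        cong: if_cong)
  also have "l *\<^sub>R mat 1 - A = U ** diag_matrix (\<lambda>i. l - d i) ** transpose U"
    using conjugate_diag_matrix_add[of "\<lambda>i. l - d i" d]
    by (simp add: A conjugate_diag_matrix_scaleR_mat_1 algebra_simps)
  also have "det \<dots> = det (transpose U ** U) * det (diag_matrix (\<lambda>i. l - d i))"
    by (simp add: det_mul)
  also have "\<dots> = (\<Prod>i\<in>UNIV. l - d i)"
    using U by (subst det_diagonal) (auto simp: orthogonal_matrix_def diag_matrix_def)
  finally show ?thesis .
qed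

text \<open>Real polynomials with equal values are equal, so \<open>charpoly A\<close> splits into
  linear factors and its roots are the entries of \<open>d\<close> with multiplicity. This links the
  algebraic definition of \<open>eigenvalues\<close> to the spectral theorem.\<close>

lemma eigenvalues_conjugate:
  assumes A: "A = U ** diag_matrix d ** transpose U"
  shows "eigenvalues A = image_mset d (mset_set UNIV)"
proof -
  have "charpoly A = (\<Prod>i\<in>UNIV. [:- d i, 1:])"
    by (subst poly_eq_poly_eq_iff[symmetric]) (simp add: fun_eq_iff poly_charpoly_conjugate[OF A] poly_prod)
  then have "eigenvalues A = (\<Sum>i\<in>UNIV. {#d i#})"
    by (simp add: eigenvalues_def proots_prod)
  also have "\<dots> = image_mset d (mset_set UNIV)"
    by (simp add: sum_unfold_sum_mset)
  finally show ?thesis .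
qed

end

lemma trace_poly_matrix:
  fixes A :: "real^'n^'n"
  assumes "transpose A = A"
  shows "trace (poly_matrix P A) = (\<Sum>l\<in>#eigenvalues A. poly P l)"
proof -
  obtain U d where "orthogonal_matrix U" "A = U ** diag_matrix d ** transpose U"
    using symmetric_matrix_diagonalization[OF assms] by metis
  then show ?thesis
    by (simp add: poly_matrix_conjugate trace_conjugate_diag_matrix eigenvalues_conjugate
        sum_unfold_sum_mset image_mset.compositionality comp_def)
qed

text \<open>A polynomial in a symmetric matrix is symmetric, so the product is its square. The form
  with a transpose is the one in which second moments of \<open>B *v u\<close> come out.\<close>

lemma trace_poly_matrix_power2:
  fixes A :: "real^'n^'n"
  assumes "transpose A = A"
  shows "trace (transpose (poly_matrix P A) ** poly_matrix P A) = (\<Sum>l\<in>#eigenvalues A. (poly P l)\<^sup>2)"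
proof -
  obtain U d where "orthogonal_matrix U" "A = U ** diag_matrix d ** transpose U"
    using symmetric_matrix_diagonalization[OF assms] by metis
  then show ?thesis
    by (simp add: poly_matrix_conjugate transpose_conjugate_diag_matrix conjugate_diag_matrix_mult
        trace_conjugate_diag_matrix eigenvalues_conjugate
        sum_unfold_sum_mset image_mset.compositionality comp_def power2_eq_square)
qed

lemma size_eigenvalues:
  fixes A :: "real^'n^'n"
  assumes "transpose A = A"
  shows "size (eigenvalues A) = CARD('n)"
proof -
  obtain U d where "orthogonal_matrix U" "A = U ** diag_matrix d ** transpose U"
    using symmetric_matrix_diagonalization[OF assms] by metis
  then show ?thesis
    by (simp add: eigenvalues_conjugate)
qed

subsection \<open>Residual polynomials\<close>

text \<open>Derivatives are unique, which settles the definite description in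
  \<open>gradient\<close>.\<close>

lemma gradient_eqI:
  assumes "GDERIV f x :> g"
  shows "gradient f x = g"
  unfolding gradient_def
proof (rule the_equality)
  show "GDERIV f x :> g" by (rule assms)
next
  fix g' assume "GDERIV f x :> g'"
  then have "(\<lambda>h. h \<bullet> g') = (\<lambda>h. h \<bullet> g)"
    using assms unfolding gderiv_def by (rule has_derivative_unique)
  then show "g' = g"
    by (metis vector_eq_ldot)
qed

text \<open>Symmetry of \<open>H\<close> makes the two terms of the product rule agree, and their
  sum absorbs the factor 1/2.\<close>

lemma gradient_quadratic:
  assumes "transpose H = H"
  shows "gradient (quadratic H z) x = H *v (x - z)"
proof (rule gradient_eqI, unfold gderiv_def quadratic_def)
  have sym: "(H *v v) \<bullet> w = v \<bullet> (H *v w)" for v w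
    by (rule symmetric_matrix_inner[OF assms])
  have diff: "((\<lambda>x. x - z) has_derivative (\<lambda>h. h)) (at x)"
    by (auto intro!: derivative_eq_intros)
  then have "((\<lambda>x. H *v (x - z)) has_derivative (*v) H) (at x)"
    by (rule bounded_linear.has_derivative[OF matrix_vector_mul_bounded_linear])
  with diff have "((\<lambda>x. 1 / 2 * ((x - z) \<bullet> (H *v (x - z)))) has_derivative
      (\<lambda>h. 1 / 2 * ((x - z) \<bullet> (H *v h) + h \<bullet> (H *v (x - z))))) (at x)"
    by (intro has_derivative_mult_right has_derivative_inner)
  moreover have "(x - z) \<bullet> (H *v h) = h \<bullet> (H *v (x - z))" for h
    using sym[of "x - z" h] by (simp add: inner_commute)
  ultimately show "((\<lambda>x. 1 / 2 * ((x - z) \<bullet> (H *v (x - z)))) has_derivative (\<lambda>h. h \<bullet> (H *v (x - z)))) (at x)"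
    by simp
qed

text \<open>The starting error contributes the constant 1, and each gradient applies
  \<open>H\<close> once more to an earlier error, which is multiplication by the indeterminate;
  \<open>pCons 1\<close> does both. All earlier indices are called, so termination is measured by
  the index.\<close>

function recursive_residual :: "(nat \<Rightarrow> nat \<Rightarrow> real) \<Rightarrow> nat \<Rightarrow> real poly" where
  "recursive_residual c 0 = 1"
| "recursive_residual c (Suc t) = pCons 1 (\<Sum>s\<le>t. smult (c t s) (recursive_residual c s))"
  by pat_completeness auto
termination
  by (relation "Wellfounded.measure snd") auto

lemma recursive_residual_at_0: "poly (recursive_residual c t) 0 = 1"
  by (cases t) auto

lemma degree_recursive_residual: "degree (recursive_residual c t) \<le> t"
proof (induction t rule: less_induct)
  case (less t)
  show ?case
  proof (cases t)
    case (Suc t')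
    have "degree (\<Sum>s\<le>t'. smult (c t' s) (recursive_residual c s)) \<le> t'"
    proof (rule degree_sum_le)
      fix s assume "s \<in> {..t'}"
      then have "degree (recursive_residual c s) \<le> s" "s \<le> t'"
        using less.IH Suc by auto
      then show "degree (smult (c t' s) (recursive_residual c s)) \<le> t'"
        by (meson degree_smult_le order_trans)
    qed simp
    with Suc show ?thesis
      by (auto intro: order_trans[OF degree_pCons_le])
  qed simp
qed

lemma matrix_vector_mult_sum_left:
  fixes x :: "real^'n"
  shows "(\<Sum>s\<in>S. B s) *v x = (\<Sum>s\<in>S. B s *v x)"
  by (induction S rule: infinite_finite_induct) (simp_all add: matrix_vector_mult_add_rdistrib)

lemma matrix_vector_mult_sum_right:
  fixes A :: "real^'n^'m"
  shows "A *v (\<Sum>s\<in>S. x s) = (\<Sum>s\<in>S. A *v x s)"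
  by (induction S rule: infinite_finite_induct) (simp_all add: matrix_vector_right_distrib)

lemma poly_matrix_recursive_residual_Suc:
  "poly_matrix (recursive_residual c (Suc t)) H *v v =
     v + (\<Sum>s\<le>t. c t s *\<^sub>R (H *v (poly_matrix (recursive_residual c s) H *v v)))"
  by (simp add: poly_matrix_pCons poly_matrix_sum poly_matrix_smult matrix_vector_mult_add_rdistrib
      matrix_vector_mult_sum_left matrix_vector_mult_sum_right matrix_vector_mult_scaleR
      scaleR_matrix_vector_assoc[symmetric] matrix_vector_mul_assoc[symmetric])

text \<open>The forward direction, by strong induction over all earlier gradients, gives the
  residual property. The converse manufactures iterates for chosen data, which the uniqueness
  argument needs.\<close>

lemma oblivious_iterates_quadratic_iff:
  fixes H :: "real^'n^'n"
  assumes sym: "transpose H = H"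
  shows "oblivious_iterates c (quadratic H z) x \<longleftrightarrow>
           (\<forall>t. x t - z = poly_matrix (recursive_residual c t) H *v (x 0 - z))"
    (is "?L \<longleftrightarrow> ?R")
proof
  assume L: ?L
  show ?R
  proof
    fix t
    show "x t - z = poly_matrix (recursive_residual c t) H *v (x 0 - z)"
    proof (induction t rule: less_induct)
      case (less t)
      show ?case
      proof (cases t)
        case 0
        then show ?thesis by (simp add: poly_matrix_def)
      next
        case (Suc t')
        have "x t - z = (x 0 - z) + (\<Sum>s\<le>t'. c t' s *\<^sub>R (H *v (x s - z)))"
          using L by (simp add: oblivious_iterates_def Suc gradient_quadratic[OF sym])
        also have "(\<Sum>s\<le>t'. c t' s *\<^sub>R (H *v (x s - z))) =
            (\<Sum>s\<le>t'. c t' s *\<^sub>R (H *v (poly_matrix (recursive_residual c s) H *v (x 0 - z))))"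
          by (intro sum.cong refl) (subst less.IH, auto simp: Suc)
        finally show ?thesis
          by (simp only: Suc poly_matrix_recursive_residual_Suc)
      qed
    qed
  qed
next
  assume R: ?R
  show ?L
    unfolding oblivious_iterates_def gradient_quadratic[OF sym]
  proof
    fix t
    have "x (Suc t) - z = (x 0 - z) +
        (\<Sum>s\<le>t. c t s *\<^sub>R (H *v (poly_matrix (recursive_residual c s) H *v (x 0 - z))))"
      by (simp only: R[rule_format, of "Suc t"] poly_matrix_recursive_residual_Suc)
    also have "\<dots> = (x 0 - z) + (\<Sum>s\<le>t. c t s *\<^sub>R (H *v (x s - z)))"
      by (simp only: R[rule_format, symmetric])
    finally have "x (Suc t) - z = (x 0 - z) + (\<Sum>s\<le>t. c t s *\<^sub>R (H *v (x s - z)))" .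
    then show "x (Suc t) = x 0 + (\<Sum>s\<le>t. c t s *\<^sub>R (H *v (x s - z)))"
      by (simp add: algebra_simps)
  qed
qed

section \<open>Uniqueness of the residual polynomial\<close>

lemma poly_matrix_scaleR_mat_1: "poly_matrix P (l *\<^sub>R mat 1 :: real^'n^'n) = poly P l *\<^sub>R mat 1"
proof (induction P)
  case (pCons a P)
  then show ?case
    by (simp add: poly_matrix_pCons matrix_mult_scaleR_right scaleR_add_left mult.commute)
qed simp

lemma spd_matrix_scaleR_mat_1:
  assumes "l > 0"
  shows "spd_matrix (l *\<^sub>R mat 1 :: real^'n^'n)"
proof -
  have "transpose (l *\<^sub>R mat 1 :: real^'n^'n) = l *\<^sub>R mat 1"
    by (auto simp: transpose_def mat_def vec_eq_iff)
  with assms show ?thesis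
    by (simp add: spd_matrix_def scaleR_matrix_vector_assoc[symmetric])
qed

lemma is_residual_polynomial_recursive_residual:
  "is_residual_polynomial TYPE('n::finite) c t (recursive_residual c t)"
  unfolding is_residual_polynomial_def
  using degree_recursive_residual recursive_residual_at_0 oblivious_iterates_quadratic_iff
  by (metis spd_matrix_def)

text \<open>On \<open>l *\<^sub>R mat 1\<close> the residual identity compares the values of the two
  polynomials at \<open>l\<close>; agreement at infinitely many points makes them equal.\<close>

lemma is_residual_polynomial_unique:
  assumes P: "is_residual_polynomial TYPE('n::finite) c t P"
  shows "P = recursive_residual c t"
proof -
  have eq: "poly P l = poly (recursive_residual c t) l" if l: "l > 0" for l
  proof -
    define H :: "real^'n^'n" where "H = l *\<^sub>R mat 1"
    \<comment> \<open>The all-ones vector; being nonzero, it can be cancelled from the two multiples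
      of it at the end.\<close>
    define v :: "real^'n" where "v = 1"
    define x where "x s = poly_matrix (recursive_residual c s) H *v v" for s
    have H: "spd_matrix H" using spd_matrix_scaleR_mat_1[OF l] by (simp add: H_def)
    have x0: "x 0 = v" by (simp add: x_def poly_matrix_def)
    have "oblivious_iterates c (quadratic H 0) x"
      using H by (simp add: oblivious_iterates_quadratic_iff spd_matrix_def x0) (simp add: x_def)
    then have "x t = poly_matrix P H *v v"
      using P H unfolding is_residual_polynomial_def by (metis diff_zero x0)
    then have "poly (recursive_residual c t) l *\<^sub>R v = poly P l *\<^sub>R v"
      by (simp add: x_def H_def poly_matrix_scaleR_mat_1 scaleR_matrix_vector_assoc[symmetric])
    moreover have "v \<noteq> 0" by (simp add: v_def)
    ultimately show ?thesis by simp
  qed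
  have "P - recursive_residual c t = 0"
  proof (rule ccontr)
    assume "P - recursive_residual c t \<noteq> 0"
    then have "finite {l. poly (P - recursive_residual c t) l = 0}"
      by (rule poly_roots_finite)
    moreover have "{0<..} \<subseteq> {l. poly (P - recursive_residual c t) l = 0}"
      using eq by auto
    ultimately show False
      using infinite_Ioi finite_subset by blast
  qed
  then show ?thesis by simp
qed

lemma residual_polynomial_eq: "residual_polynomial TYPE('n::finite) c t = recursive_residual c t"
  unfolding residual_polynomial_def
  by (rule the_equality) (rule is_residual_polynomial_recursive_residual, rule is_residual_polynomial_unique)

subsection \<open>Measurability of spectral sums\<close>

lemma continuous_on_matrix_mult:
  fixes f :: "'b::topological_space \<Rightarrow> real^'n^'m" and g :: "'b \<Rightarrow> real^'k^'n"
  assumes "continuous_on S f" "continuous_on S g"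
  shows "continuous_on S (\<lambda>x. f x ** g x)"
  unfolding matrix_matrix_mult_def by (intro continuous_intros assms)

lemma continuous_on_matrix_vector_mult:
  fixes f :: "'b::topological_space \<Rightarrow> real^'n^'m" and g :: "'b \<Rightarrow> real^'n"
  assumes "continuous_on S f" "continuous_on S g"
  shows "continuous_on S (\<lambda>x. f x *v g x)"
  unfolding matrix_vector_mult_def by (intro continuous_intros assms)

lemma continuous_on_poly_matrix:
  assumes "continuous_on S f"
  shows "continuous_on S (\<lambda>x. poly_matrix P (f x))"
proof -
  have "continuous_on S (\<lambda>x. matrix_pow (f x) k)" for k
    by (induction k) (auto intro!: continuous_on_matrix_mult assms)
  then show ?thesis
    unfolding poly_matrix_def by (intro continuous_intros)
qed

lemma continuous_on_trace:
  fixes f :: "'b::topological_space \<Rightarrow> real^'n^'n"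
  assumes "continuous_on S f"
  shows "continuous_on S (\<lambda>x. trace (f x))"
  unfolding trace_def by (intro continuous_intros assms)

section \<open>Polynomial approximation on the real line\<close>

lemma polynomial_approximation:
  fixes f :: "real \<Rightarrow> real"
  assumes "continuous_on {a..b} f" "e > 0"
  obtains p where "\<And>x. x \<in> {a..b} \<Longrightarrow> \<bar>f x - poly p x\<bar> < e"
proof -
  obtain g where g: "real_polynomial_function g" "\<And>x. x \<in> {a..b} \<Longrightarrow> \<bar>f x - g x\<bar> < e"
    using Stone_Weierstrass_real_polynomial_function[OF compact_Icc assms] by blast
  from g(1) obtain a n where "g = (\<lambda>x. \<Sum>i\<le>n. a i * x ^ i)"
    unfolding real_polynomial_function_iff_sum by blast
  then have "g = poly (\<Sum>i\<le>n. monom (a i) i)"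
    by (simp add: fun_eq_iff poly_sum poly_monom)
  with g that show ?thesis by blast
qed

text \<open>Approximate within \<open>1 / (n + 1)\<close> on the interval from \<open>-n\<close> to
  \<open>n\<close>: each point lies in all but finitely many of these intervals.\<close>

lemma continuous_pointwise_limit_of_polynomials:
  fixes f :: "real \<Rightarrow> real"
  assumes "continuous_on UNIV f"
  obtains p where "\<And>x. (\<lambda>n. poly (p n) x) \<longlonglongrightarrow> f x"
proof -
  have "\<exists>p. \<forall>x\<in>{- real n..real n}. \<bar>f x - poly p x\<bar> < inverse (real (Suc n))" for n
  proof -
    have "continuous_on {- real n..real n} f"
      using assms continuous_on_subset by blast
    then show ?thesis
      by (rule polynomial_approximation[where e = "inverse (real (Suc n))"]) (simp, blast)
  qed
  then obtain p where p: "\<And>n x. x \<in> {- real n..real n} \<Longrightarrow> \<bar>f x - poly (p n) x\<bar> < inverse (real (Suc n))"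
    by metis
  have "(\<lambda>n. poly (p n) x) \<longlonglongrightarrow> f x" for x
  proof -
    have "(\<lambda>n. poly (p n) x - f x) \<longlonglongrightarrow> 0"
    proof (rule Lim_null_comparison)
      obtain N where N: "\<bar>x\<bar> \<le> real N"
        using real_arch_simple by blast
      show "\<forall>\<^sub>F n in sequentially. norm (poly (p n) x - f x) \<le> inverse (real (Suc n))"
        using eventually_ge_at_top[of N]
      proof eventually_elim
        case (elim n)
        then have "x \<in> {- real n..real n}" using N by auto
        from p[OF this] show ?case by (simp add: abs_minus_commute)
      qed
    qed (rule LIMSEQ_inverse_real_of_nat)
    then show ?thesis by (simp add: LIM_zero_iff)
  qed
  with that show ?thesis by blast
qed

lemma tendsto_sum_mset:
  fixes f :: "'b \<Rightarrow> 'c \<Rightarrow> 'd::topological_comm_monoid_add"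
  assumes "\<And>x. ((\<lambda>n. f n x) \<longlongrightarrow> g x) F"
  shows "((\<lambda>n. \<Sum>x\<in>#E. f n x) \<longlongrightarrow> (\<Sum>x\<in>#E. g x)) F"
  by (induction E) (auto intro!: tendsto_add assms)

text \<open>The eigenvalues themselves are never chosen measurably: for polynomial \<open>\<phi>\<close> the sum is a
  trace, hence continuous in the matrix, and a continuous \<open>\<phi>\<close> is a pointwise limit of polynomials.\<close>

lemma borel_measurable_spectral_sum:
  fixes H :: "'a \<Rightarrow> real^'n^'n" and \<phi> :: "real \<Rightarrow> real"
  assumes H: "H \<in> borel_measurable M" and sym: "\<And>\<omega>. \<omega> \<in> space M \<Longrightarrow> transpose (H \<omega>) = H \<omega>"
    and \<phi>: "continuous_on UNIV \<phi>"
  shows "(\<lambda>\<omega>. \<Sum>l\<in>#eigenvalues (H \<omega>). \<phi> l) \<in> borel_measurable M"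
proof -
  obtain p where p: "\<And>x. (\<lambda>n. poly (p n) x) \<longlonglongrightarrow> \<phi> x"
    using continuous_pointwise_limit_of_polynomials[OF \<phi>] by blast
  show ?thesis
  proof (rule borel_measurable_LIMSEQ_real)
    show "(\<lambda>n. trace (poly_matrix (p n) (H \<omega>))) \<longlonglongrightarrow> (\<Sum>l\<in>#eigenvalues (H \<omega>). \<phi> l)"
      if "\<omega> \<in> space M" for \<omega>
      using p by (simp add: trace_poly_matrix sym[OF that] tendsto_sum_mset)
    show "(\<lambda>\<omega>. trace (poly_matrix (p n) (H \<omega>))) \<in> borel_measurable M" for n
      using H by (rule measurable_compose)
        (intro borel_measurable_continuous_onI continuous_on_trace continuous_on_poly_matrix continuous_on_id)
  qed
qed

subsection \<open>Spectral distributions\<close>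

text \<open>Recognising the set function as the law of \<open>d i\<close> at a uniformly random
  index \<open>i\<close> shows that it is a measure, so that \<open>measure_of\<close> really takes
  these values.\<close>

lemma empirical_spectral_distribution_eq_distr:
  assumes "eigenvalues (A :: real^'n^'n) = image_mset d (mset_set (UNIV :: 'n set))"
  shows "empirical_spectral_distribution A = distr (measure_pmf (pmf_of_set UNIV)) borel d"
proof -
  define D where "D = distr (measure_pmf (pmf_of_set (UNIV :: 'n set))) borel d"
  have "(\<Sum>l\<in>#eigenvalues A. emeasure (return borel l) S) / of_nat CARD('n) = emeasure D S"
    if S: "S \<in> sets borel" for S
  proof -
    have "emeasure D S = emeasure (measure_pmf (pmf_of_set (UNIV :: 'n set))) (d -` S)"
      using S by (simp add: D_def emeasure_distr)
    also have "\<dots> = (\<integral>\<^sup>+i. indicator (d -` S) i \<partial>measure_pmf (pmf_of_set (UNIV :: 'n set)))"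
      by simp
    also have "\<dots> = (\<Sum>i\<in>UNIV. indicator (d -` S) i) / of_nat CARD('n)"
      by (subst nn_integral_pmf_of_set) (auto simp: ennreal_of_nat_eq_real_of_nat)
    finally show ?thesis
      using S by (simp add: assms sum_unfold_sum_mset image_mset.compositionality comp_def indicator_def)
  qed
  \<comment> \<open>\<open>measure_of\<close> looks only at values on Borel sets, and rebuilding
    \<open>D\<close> from its own values returns \<open>D\<close>.\<close>
  then have "empirical_spectral_distribution A = measure_of UNIV (sets borel) (emeasure D)"
    unfolding empirical_spectral_distribution_def
    by (intro measure_of_eq) (auto simp: sets.sigma_sets_eq[of borel, simplified])
  also have "\<dots> = D"
    using measure_of_of_measure[of D] by (simp add: D_def)
  finally show ?thesis by (simp add: D_def)
qed

lemma integral_empirical_spectral_distribution: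
  fixes A :: "real^'n^'n" and \<phi> :: "real \<Rightarrow> real"
  assumes sym: "transpose A = A" and \<phi>: "\<phi> \<in> borel_measurable borel"
  shows "(LINT l|empirical_spectral_distribution A. \<phi> l) = (\<Sum>l\<in>#eigenvalues A. \<phi> l) / CARD('n)"
proof -
  obtain U d where "orthogonal_matrix U" "A = U ** diag_matrix d ** transpose U"
    using symmetric_matrix_diagonalization[OF sym] by metis
  then have d: "eigenvalues A = image_mset d (mset_set UNIV)"
    by (rule eigenvalues_conjugate)
  then have "(LINT l|empirical_spectral_distribution A. \<phi> l) =
      (LINT i|measure_pmf (pmf_of_set UNIV). \<phi> (d i))"
    using \<phi> by (simp add: empirical_spectral_distribution_eq_distr integral_distr)
  also have "\<dots> = (\<Sum>l\<in>#eigenvalues A. \<phi> l) / CARD('n)"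
    by (subst integral_pmf_of_set)
      (simp_all add: d sum_unfold_sum_mset image_mset.compositionality comp_def)
  finally show ?thesis .
qed

text \<open>Compact support bounds \<open>\<phi>\<close>, so the eigenvalue averages are bounded and
  integrable over the probability space; integrability over \<open>\<mu>\<close> comes from the
  definition. Both Bochner integrals then become nonnegative ones.\<close>

lemma nn_integral_expected_spectral_distribution_bounded_support:
  fixes H :: "'a \<Rightarrow> real^'n^'n" and \<phi> :: "real \<Rightarrow> real"
  assumes M: "prob_space M" and H: "H \<in> borel_measurable M"
    and sym: "\<And>\<omega>. \<omega> \<in> space M \<Longrightarrow> transpose (H \<omega>) = H \<omega>"
    and \<mu>: "expected_spectral_distribution M H \<mu>"
    and \<phi>: "continuous_on UNIV \<phi>" "\<And>l. 0 \<le> \<phi> l" "bounded {l. \<phi> l \<noteq> 0}"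
  shows "(\<integral>\<^sup>+l. ennreal (\<phi> l) \<partial>\<mu>) =
           (\<integral>\<^sup>+\<omega>. ennreal ((\<Sum>l\<in>#eigenvalues (H \<omega>). \<phi> l) / CARD('n)) \<partial>M)"
proof -
  interpret prob_space M by (rule M)
  define m where "m \<omega> = (\<Sum>l\<in>#eigenvalues (H \<omega>). \<phi> l) / CARD('n)" for \<omega>
  have compact: "compact (closure {l. \<phi> l \<noteq> 0})"
    using \<phi>(3) by simp
  have "compact (\<phi> ` closure {l. \<phi> l \<noteq> 0})"
    using compact \<phi>(1) by (intro compact_continuous_image) (auto intro: continuous_on_subset)
  then have "bounded (\<phi> ` closure {l. \<phi> l \<noteq> 0})"
    by (rule compact_imp_bounded)
  then obtain C0 where C0: "\<And>l. l \<in> closure {l. \<phi> l \<noteq> 0} \<Longrightarrow> \<bar>\<phi> l\<bar> \<le> C0"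
    by (auto simp: bounded_iff)
  \<comment> \<open>The maximum with 0 also covers points outside the support, where
    \<open>C0\<close> says nothing.\<close>
  define C where "C = max 0 C0"
  have C: "\<phi> l \<le> C" for l
    using C0[of l] closure_subset[of "{l. \<phi> l \<noteq> 0}"] by (cases "\<phi> l = 0") (auto simp: C_def)
  have m_nonneg: "0 \<le> m \<omega>" for \<omega>
    using sum_mset_mono[of "eigenvalues (H \<omega>)" "\<lambda>_. 0" \<phi>] \<phi>(2) by (simp add: m_def)
  have m_le: "m \<omega> \<le> C" if "\<omega> \<in> space M" for \<omega>
  proof -
    have "(\<Sum>l\<in>#eigenvalues (H \<omega>). \<phi> l) \<le> (\<Sum>l\<in>#eigenvalues (H \<omega>). C)"
      by (intro sum_mset_mono C)
    then show ?thesis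
      by (simp add: m_def size_eigenvalues[OF sym[OF that]] field_simps)
  qed
  have m_measurable: "m \<in> borel_measurable M"
    unfolding m_def using borel_measurable_spectral_sum[OF H sym \<phi>(1)] by simp
  have m_integrable: "integrable M m"
    by (rule integrable_const_bound[where B = C]) (use m_nonneg m_le m_measurable in auto)
  have "integrable \<mu> \<phi>" and eq: "(LINT l|\<mu>. \<phi> l) =
      (LINT \<omega>|M. (LINT l|empirical_spectral_distribution (H \<omega>). \<phi> l))"
    using \<mu> \<phi>(1) compact by (auto simp: expected_spectral_distribution_def)
  then have "(\<integral>\<^sup>+l. ennreal (\<phi> l) \<partial>\<mu>) = ennreal (LINT l|\<mu>. \<phi> l)"
    using \<phi>(2) by (intro nn_integral_eq_integral) auto
  also have "(LINT l|\<mu>. \<phi> l) = (LINT \<omega>|M. m \<omega>)"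
    unfolding eq m_def
    by (intro Bochner_Integration.integral_cong refl integral_empirical_spectral_distribution sym
        borel_measurable_continuous_onI \<phi>(1))
  also have "ennreal \<dots> = (\<integral>\<^sup>+\<omega>. ennreal (m \<omega>) \<partial>M)"
    using m_integrable m_nonneg by (intro nn_integral_eq_integral[symmetric]) auto
  finally show ?thesis by (simp add: m_def)
qed

text \<open>A measure \<open>\<mu>\<close> is only specified by compactly supported test functions; the cut-offs
  \<open>max 0 (min 1 (n - \<bar>l\<bar>))\<close> and monotone convergence extend this to nonnegative continuous ones.\<close>

lemma nn_integral_expected_spectral_distribution:
  fixes H :: "'a \<Rightarrow> real^'n^'n" and \<phi> :: "real \<Rightarrow> real"
  assumes M: "prob_space M" and H: "H \<in> borel_measurable M"
    and sym: "\<And>\<omega>. \<omega> \<in> space M \<Longrightarrow> transpose (H \<omega>) = H \<omega>"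
    and \<mu>: "expected_spectral_distribution M H \<mu>"
    and \<phi>: "continuous_on UNIV \<phi>" "\<And>l. 0 \<le> \<phi> l"
  shows "(\<integral>\<^sup>+l. ennreal (\<phi> l) \<partial>\<mu>) =
           (\<integral>\<^sup>+\<omega>. ennreal ((\<Sum>l\<in>#eigenvalues (H \<omega>). \<phi> l) / CARD('n)) \<partial>M)"
proof -
  define \<psi> where "\<psi> n l = \<phi> l * max 0 (min 1 (real n - \<bar>l\<bar>))" for n l
  have cont: "continuous_on UNIV (\<psi> n)" for n
    unfolding \<psi>_def by (intro continuous_intros \<phi>)
  have nonneg: "0 \<le> \<psi> n l" for n l
    using \<phi>(2) by (simp add: \<psi>_def)
  have bounded: "bounded {l. \<psi> n l \<noteq> 0}" for n
    by (rule bounded_subset[OF bounded_closed_interval[of "- real n" "real n"]])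
      (auto simp: \<psi>_def max_def min_def split: if_splits)
  have mono: "\<psi> m l \<le> \<psi> n l" if "m \<le> n" for m n l
    using \<phi>(2)[of l] that unfolding \<psi>_def by (intro mult_left_mono) auto
  have lim: "(\<lambda>n. \<psi> n l) \<longlonglongrightarrow> \<phi> l" for l
  proof (rule tendsto_eventually)
    \<comment> \<open>From \<open>N\<close> on the cut-off equals 1 at \<open>l\<close>.\<close>
    obtain N where N: "\<bar>l\<bar> + 1 \<le> real N"
      using real_arch_simple by blast
    show "\<forall>\<^sub>F n in sequentially. \<psi> n l = \<phi> l"
      using eventually_ge_at_top[of N] by eventually_elim (use N in \<open>auto simp: \<psi>_def\<close>)
  qed
  have sets: "sets \<mu> = sets borel"
    using \<mu> by (simp add: expected_spectral_distribution_def)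
  have "(\<lambda>n. \<integral>\<^sup>+l. ennreal (\<psi> n l) \<partial>\<mu>) \<longlonglongrightarrow> (\<integral>\<^sup>+l. ennreal (\<phi> l) \<partial>\<mu>)"
  proof (rule nn_integral_LIMSEQ)
    show "incseq (\<lambda>n l. ennreal (\<psi> n l))"
      by (auto simp: incseq_def le_fun_def intro!: ennreal_leI mono)
    show "(\<lambda>l. ennreal (\<psi> n l)) \<in> borel_measurable \<mu>" for n
      using borel_measurable_continuous_onI[OF cont[of n]]
      by (simp add: measurable_cong_sets[OF sets refl])
  qed (auto intro: lim)
  moreover have "(\<lambda>n. \<integral>\<^sup>+\<omega>. ennreal ((\<Sum>l\<in>#eigenvalues (H \<omega>). \<psi> n l) / CARD('n)) \<partial>M) \<longlonglongrightarrow>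
      (\<integral>\<^sup>+\<omega>. ennreal ((\<Sum>l\<in>#eigenvalues (H \<omega>). \<phi> l) / CARD('n)) \<partial>M)"
  proof (rule nn_integral_LIMSEQ)
    show "incseq (\<lambda>n \<omega>. ennreal ((\<Sum>l\<in>#eigenvalues (H \<omega>). \<psi> n l) / CARD('n)))"
      by (auto simp: incseq_def le_fun_def intro!: ennreal_leI divide_right_mono sum_mset_mono mono)
    show "(\<lambda>\<omega>. ennreal ((\<Sum>l\<in>#eigenvalues (H \<omega>). \<psi> n l) / CARD('n))) \<in> borel_measurable M" for n
      using borel_measurable_spectral_sum[OF H sym cont[of n]] by simp
    show "(\<lambda>n. ennreal ((\<Sum>l\<in>#eigenvalues (H \<omega>). \<psi> n l) / CARD('n))) \<longlonglongrightarrow>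
        ennreal ((\<Sum>l\<in>#eigenvalues (H \<omega>). \<phi> l) / CARD('n))" for \<omega>
      by (intro tendsto_ennrealI tendsto_divide tendsto_sum_mset lim tendsto_const) simp
  qed
  ultimately show ?thesis
    using nn_integral_expected_spectral_distribution_bounded_support[OF M H sym \<mu> cont nonneg bounded]
    by (simp add: LIMSEQ_unique)
qed

subsection \<open>Independence and second moments\<close>

text \<open>Independence gives equality on rectangles, which determine a product of sigma-finite
  measures. The pair is swapped so that in the application \<open>H\<close> comes first and is
  integrated in the outer integral.\<close>

lemma independent_rvs_pair_distr:
  fixes X :: "'a \<Rightarrow> 'b::topological_space" and Y :: "'a \<Rightarrow> 'c::topological_space"
  assumes M: "prob_space M" and ind: "independent_rvs M X Y"
  shows "distr M borel Y \<Otimes>\<^sub>M distr M borel X = distr M (borel \<Otimes>\<^sub>M borel) (\<lambda>\<omega>. (Y \<omega>, X \<omega>))"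
proof -
  interpret prob_space M by (rule M)
  have X [measurable]: "X \<in> borel_measurable M" and Y [measurable]: "Y \<in> borel_measurable M"
    and indep: "indep_set {X -` A \<inter> space M | A. A \<in> sets borel} {Y -` B \<inter> space M | B. B \<in> sets borel}"
    using ind by (auto simp: independent_rvs_def)
  interpret X: prob_space "distr M borel X" by (rule prob_space_distr) simp
  interpret Y: prob_space "distr M borel Y" by (rule prob_space_distr) simp
  show ?thesis
  proof (rule pair_measure_eqI)
    fix B :: "'c set" and A :: "'b set"
    assume "B \<in> sets (distr M borel Y)" "A \<in> sets (distr M borel X)"
    then have [measurable]: "B \<in> sets borel" "A \<in> sets borel" by simp_all
    have "prob ((X -` A \<inter> space M) \<inter> (Y -` B \<inter> space M)) =
        prob (X -` A \<inter> space M) * prob (Y -` B \<inter> space M)"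
      by (rule indep_setD[OF indep]) auto
    moreover have "(\<lambda>\<omega>. (Y \<omega>, X \<omega>)) -` (B \<times> A) \<inter> space M = (X -` A \<inter> space M) \<inter> (Y -` B \<inter> space M)"
      by auto
    ultimately show "emeasure (distr M borel Y) B * emeasure (distr M borel X) A =
        emeasure (distr M (borel \<Otimes>\<^sub>M borel) (\<lambda>\<omega>. (Y \<omega>, X \<omega>))) (B \<times> A)"
      by (simp add: emeasure_distr emeasure_eq_measure ennreal_mult'[symmetric] mult.commute)
  qed (auto intro: X.sigma_finite_measure_axioms Y.sigma_finite_measure_axioms)
qed

section \<open>Second moments of isotropic vectors\<close>

lemma power2_norm_matrix_vector_mult:
  fixes B :: "real^'n^'m"
  shows "(norm (B *v u))\<^sup>2 = (\<Sum>i\<in>UNIV. \<Sum>j\<in>UNIV. \<Sum>k\<in>UNIV. (B $ i $ j * B $ i $ k) * (u $ j * u $ k))"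
  by (simp add: dot_square_norm[symmetric] inner_vec_def matrix_vector_mult_def sum_product algebra_simps)

text \<open>The expanded square is linear in the products
  \<open>u \<omega> $ j * u \<omega> $ k\<close>. Isotropy keeps only the terms with
  \<open>j = k\<close>, leaving \<open>s\<close> times the squared Frobenius norm of
  \<open>B\<close>.\<close>

lemma nn_integral_power2_norm_isotropic:
  fixes u :: "'a \<Rightarrow> real^'n" and B :: "real^'n^'m"
  assumes u: "has_bochner_integral M (\<lambda>\<omega>. (\<chi> i j. u \<omega> $ i * u \<omega> $ j) :: real^'n^'n) (s *\<^sub>R mat 1)"
  shows "(\<integral>\<^sup>+\<omega>. ennreal ((norm (B *v u \<omega>))\<^sup>2) \<partial>M) = ennreal (s * trace (transpose B ** B))"
proof -
  have comp: "has_bochner_integral M (\<lambda>\<omega>. u \<omega> $ j * u \<omega> $ k) (if j = k then s else 0)" for j k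
  proof -
    \<comment> \<open>Reading off an entry is bounded linear, so it commutes with the matrix-valued
      integral.\<close>
    have "bounded_linear (\<lambda>A :: real^'n^'n. A $ j $ k)"
      by (intro bounded_linear_compose[OF bounded_linear_vec_nth bounded_linear_vec_nth])
    from has_bochner_integral_bounded_linear[OF this u] show ?thesis
      by (simp add: mat_def if_distrib[of "\<lambda>x. s * x"] cong: if_cong)
  qed
  have "has_bochner_integral M (\<lambda>\<omega>. (norm (B *v u \<omega>))\<^sup>2)
      (\<Sum>i\<in>UNIV. \<Sum>j\<in>UNIV. \<Sum>k\<in>UNIV. (B $ i $ j * B $ i $ k) * (if j = k then s else 0))"
    unfolding power2_norm_matrix_vector_mult
    by (intro has_bochner_integral_sum has_bochner_integral_mult_right comp)
  also have "(\<Sum>i\<in>UNIV. \<Sum>j\<in>UNIV. \<Sum>k\<in>UNIV. (B $ i $ j * B $ i $ k) * (if j = k then s else 0)) =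
      (\<Sum>i\<in>UNIV. \<Sum>j\<in>UNIV. s * (B $ i $ j * B $ i $ j))"
    by (simp add: if_distrib[of "\<lambda>x. _ * x"] mult.commute[of s] cong: if_cong)
  also have "\<dots> = s * trace (transpose B ** B)"
    by (subst sum.swap) (simp add: trace_def transpose_def matrix_matrix_mult_def sum_distrib_left)
  finally have "has_bochner_integral M (\<lambda>\<omega>. (norm (B *v u \<omega>))\<^sup>2) (s * trace (transpose B ** B))" .
  then show ?thesis
    by (subst nn_integral_eq_integral) (auto simp: has_bochner_integral_iff)
qed

text \<open>Both expectations are integrals with values in \<open>ennreal\<close>, so the identity
  includes the case in which they are infinite.\<close>

theorem theorem5:
  fixes M :: "'a measure"
    and H :: "'a \<Rightarrow> real^'n^'n"
    and xstar :: "'a \<Rightarrow> real^'n"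
    and x :: "nat \<Rightarrow> 'a \<Rightarrow> real^'n"
    and c :: "nat \<Rightarrow> nat \<Rightarrow> real"
    and R :: real
    and \<mu> :: "real measure"
    and t :: nat
  assumes "prob_space M"
    and "H \<in> borel_measurable M"
    and "x 0 \<in> borel_measurable M"
    and "xstar \<in> borel_measurable M"
    and "\<And>\<omega>. \<omega> \<in> space M \<Longrightarrow> spd_matrix (H \<omega>)"
    and "independent_rvs M (\<lambda>\<omega>. x 0 \<omega> - xstar \<omega>) H"
    and "has_bochner_integral M
           (\<lambda>\<omega>. (\<chi> i j. (x 0 \<omega> - xstar \<omega>) $ i * (x 0 \<omega> - xstar \<omega>) $ j) :: real^'n^'n)
           ((R\<^sup>2 / real CARD('n)) *\<^sub>R mat 1)"
    and "expected_spectral_distribution M H \<mu>"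
    and "\<And>\<omega>. \<omega> \<in> space M \<Longrightarrow>
           oblivious_iterates c (quadratic (H \<omega>) (xstar \<omega>)) (\<lambda>s. x s \<omega>)"
  shows "(\<integral>\<^sup>+\<omega>. ennreal ((norm (x t \<omega> - xstar \<omega>))\<^sup>2) \<partial>M) =
           ennreal (R\<^sup>2) * (\<integral>\<^sup>+l. ennreal ((poly (residual_polynomial TYPE('n) c t) l)\<^sup>2) \<partial>\<mu>)"
proof -
  interpret prob_space M by (rule assms(1))
  define P where "P = residual_polynomial TYPE('n) c t"
  define u where "u \<omega> = x 0 \<omega> - xstar \<omega>" for \<omega>
  \<comment> \<open>Values in \<open>ennreal\<close> let Tonelli's theorem apply without an
    integrability check.\<close>
  define g where "g h v = ennreal ((norm (poly_matrix P h *v v))\<^sup>2)" for h :: "real^'n^'n" and v :: "real^'n"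
  have sym: "transpose (H \<omega>) = H \<omega>" if "\<omega> \<in> space M" for \<omega>
    using assms(5)[OF that] by (simp add: spd_matrix_def)
  have [measurable]: "H \<in> borel_measurable M" "u \<in> borel_measurable M"
    unfolding u_def using assms(2-4) by auto
  have residual: "x t \<omega> - xstar \<omega> = poly_matrix P (H \<omega>) *v u \<omega>" if "\<omega> \<in> space M" for \<omega>
    using assms(9)[OF that, unfolded oblivious_iterates_quadratic_iff[OF sym[OF that]], rule_format, of t]
    by (simp only: P_def residual_polynomial_eq u_def)
  \<comment> \<open>Joint measurability comes from joint continuity, since the Borel sets of the
    product are generated by the two Borel algebras.\<close>
  have "(\<lambda>p :: (real^'n^'n) \<times> (real^'n). g (fst p) (snd p)) \<in> borel_measurable borel"
    unfolding g_def
    by (intro measurable_compose[OF _ measurable_ennreal] borel_measurable_continuous_onI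
        continuous_intros continuous_on_matrix_vector_mult continuous_on_poly_matrix)
  then have g [measurable]: "case_prod g \<in> borel_measurable (borel \<Otimes>\<^sub>M borel)"
    by (simp add: borel_prod case_prod_beta)
  interpret u: prob_space "distr M borel u" by (rule prob_space_distr) simp
  have "(\<integral>\<^sup>+\<omega>. ennreal ((norm (x t \<omega> - xstar \<omega>))\<^sup>2) \<partial>M) = (\<integral>\<^sup>+\<omega>. g (H \<omega>) (u \<omega>) \<partial>M)"
    by (intro nn_integral_cong) (simp add: residual g_def)
  also have "\<dots> = (\<integral>\<^sup>+p. case_prod g p \<partial>distr M (borel \<Otimes>\<^sub>M borel) (\<lambda>\<omega>. (H \<omega>, u \<omega>)))"
    by (subst nn_integral_distr) auto
  also have "distr M (borel \<Otimes>\<^sub>M borel) (\<lambda>\<omega>. (H \<omega>, u \<omega>)) = distr M borel H \<Otimes>\<^sub>M distr M borel u"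
    using independent_rvs_pair_distr[OF assms(1,6)] by (simp add: u_def[abs_def])
  also have "(\<integral>\<^sup>+p. case_prod g p \<partial>(distr M borel H \<Otimes>\<^sub>M distr M borel u)) =
      (\<integral>\<^sup>+h. \<integral>\<^sup>+v. g h v \<partial>distr M borel u \<partial>distr M borel H)"
    by (subst u.nn_integral_fst[symmetric]) auto
  also have "\<dots> = (\<integral>\<^sup>+\<omega>. \<integral>\<^sup>+\<omega>'. g (H \<omega>) (u \<omega>') \<partial>M \<partial>M)"
    by (simp add: nn_integral_distr)
  also have "\<dots> = (\<integral>\<^sup>+\<omega>. ennreal (R\<^sup>2) * ennreal ((\<Sum>l\<in>#eigenvalues (H \<omega>). (poly P l)\<^sup>2) / CARD('n)) \<partial>M)"
  proof (rule nn_integral_cong)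
    fix \<omega> assume "\<omega> \<in> space M"
    \<comment> \<open>For fixed \<open>\<omega>\<close> the matrix
      \<open>poly_matrix P (H \<omega>)\<close> is constant; the eigenvalue sum is turned back into
      a trace to fit the isotropy lemma.\<close>
    have "(\<integral>\<^sup>+\<omega>'. g (H \<omega>) (u \<omega>') \<partial>M) = ennreal (R\<^sup>2 / CARD('n) * (\<Sum>l\<in>#eigenvalues (H \<omega>). (poly P l)\<^sup>2))"
      unfolding g_def trace_poly_matrix_power2[OF sym[OF \<open>\<omega> \<in> space M\<close>], symmetric]
      by (rule nn_integral_power2_norm_isotropic) (use assms(7) in \<open>simp add: u_def\<close>)
    then show "(\<integral>\<^sup>+\<omega>'. g (H \<omega>) (u \<omega>') \<partial>M) =
        ennreal (R\<^sup>2) * ennreal ((\<Sum>l\<in>#eigenvalues (H \<omega>). (poly P l)\<^sup>2) / CARD('n))"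
      by (simp add: ennreal_mult'[symmetric])
  qed
  also have "\<dots> = ennreal (R\<^sup>2) * (\<integral>\<^sup>+\<omega>. ennreal ((\<Sum>l\<in>#eigenvalues (H \<omega>). (poly P l)\<^sup>2) / CARD('n)) \<partial>M)"
  proof (rule nn_integral_cmult)
    have [measurable]: "(\<lambda>\<omega>. \<Sum>l\<in>#eigenvalues (H \<omega>). (poly P l)\<^sup>2) \<in> borel_measurable M"
      by (rule borel_measurable_spectral_sum[OF assms(2) sym]) (auto intro!: continuous_intros)
    show "(\<lambda>\<omega>. ennreal ((\<Sum>l\<in>#eigenvalues (H \<omega>). (poly P l)\<^sup>2) / CARD('n))) \<in> borel_measurable M"
      by measurable
  qed
  also have "\<dots> = ennreal (R\<^sup>2) * (\<integral>\<^sup>+l. ennreal ((poly P l)\<^sup>2) \<partial>\<mu>)"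
    by (subst nn_integral_expected_spectral_distribution[OF assms(1,2) sym assms(8)])
      (auto intro!: continuous_intros)
  finally show ?thesis by (simp add: P_def)
qed

end
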